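(* Let $X$ be a compact Hausdorff space and $G$ a finite group acting on $X$. Let $\alpha$ be the induced action of $G$ on $C(X)$ and let $E:C(X)\to C(X)^\alpha$, $E(f)=\frac1{|G|}\sum_{g\in G}\alpha_g(f)$, be the canonical conditional expectation. Then the following are equivalent: (i) $E:C(X)\to C(X)^\alpha$ is of index-finite type. (ii) $X_H$ is closed for each subgroup $H<G$. Moreover, if this is the case, the index of $E$ is $$Index(E)=\sum_{H<G}\frac{|G|}{|H|}\chi_{X_H},$$ where $\chi_{X_H}$ is the characteristic function of $X_H$.
   Context: $G$ acts on $X$ by homeomorphisms, and the induced action is $\alpha_g(f)(x)=f(g^{-1}x)$ for $f\in C(X)$, with fixed point algebra $C(X)^\alpha$. For $x\in X$, $G_x=\{g\in G: gx=x\}$. The notation $H<G$ means that $H$ is a subgroup of $G$ (including $\{\iota\}$, where $\iota$ is the identity, and $G$ itself), and $X_H=\{x\in X: G_x=H\}$, so that $X$ is the disjoint union of the $X_H$. A faithful conditional expectation $E:B\to C$ from a unital $C^*$-algebra $B$ onto a $C^*$-subalgebra $C$ containing the unit of $B$ is of index-finite type if there are finitely many $v_1,\dots,v_n\in B$ with $b=\sum_iE(bv_i)v_i^*=\sum_iv_iE(v_i^*b)$ for all $b\in B$; then $\{(v_i,v_i^* )\}$ is called a quasi-basis for $E$, and $Index(E)=\sum_iv_iv_i^*$, which is a central element of $B$ independent of the choice of quasi-basis. *)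

theory Defs
  imports "HOL-Analysis.Analysis" "HOL-Algebra.Module" "HOL-Algebra.Group_Action"
begin

section \<open>Unital C*-algebras\<close>

definition complex_ring :: "complex ring" where
  "complex_ring = \<lparr>carrier = UNIV, mult = (*), one = 1, zero = 0, add = (+)\<rparr>"

record 'a star_algebra = "(complex, 'a) module" +
  adj :: "'a \<Rightarrow> 'a"
  nrm :: "'a \<Rightarrow> real"

text \<open>The distance of the norm. The locale \<open>Metric_space\<close> demands a distance function which is
  nonnegative and symmetric also off the carrier, hence the case distinction.\<close>

definition nrm_dist :: "('a, 'm) star_algebra_scheme \<Rightarrow> 'a \<Rightarrow> 'a \<Rightarrow> real" where
  "nrm_dist B x y =
     (if x \<in> carrier B \<and> y \<in> carrier B then nrm B (x \<ominus>\<^bsub>B\<^esub> y) else 0)"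

text \<open>The zero algebra is not excluded: it is the algebra of functions on the empty space.\<close>

locale unital_cstar_algebra = Module.module complex_ring B + ring B for B (structure) +
  assumes smult_mult_left:
      "\<lbrakk>x \<in> carrier B; y \<in> carrier B\<rbrakk> \<Longrightarrow> (c \<odot> x) \<otimes> y = c \<odot> (x \<otimes> y)"
    and smult_mult_right:
      "\<lbrakk>x \<in> carrier B; y \<in> carrier B\<rbrakk> \<Longrightarrow> x \<otimes> (c \<odot> y) = c \<odot> (x \<otimes> y)"
    and adj_closed: "x \<in> carrier B \<Longrightarrow> adj B x \<in> carrier B"
    and adj_adj: "x \<in> carrier B \<Longrightarrow> adj B (adj B x) = x"
    and adj_add:
      "\<lbrakk>x \<in> carrier B; y \<in> carrier B\<rbrakk> \<Longrightarrow> adj B (x \<oplus> y) = adj B x \<oplus> adj B y"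
    and adj_mult:
      "\<lbrakk>x \<in> carrier B; y \<in> carrier B\<rbrakk> \<Longrightarrow> adj B (x \<otimes> y) = adj B y \<otimes> adj B x"
    and adj_smult: "x \<in> carrier B \<Longrightarrow> adj B (c \<odot> x) = cnj c \<odot> adj B x"
    and nrm_nonneg: "x \<in> carrier B \<Longrightarrow> 0 \<le> nrm B x"
    and nrm_eq_0: "x \<in> carrier B \<Longrightarrow> nrm B x = 0 \<longleftrightarrow> x = \<zero>"
    and nrm_triangle:
      "\<lbrakk>x \<in> carrier B; y \<in> carrier B\<rbrakk> \<Longrightarrow> nrm B (x \<oplus> y) \<le> nrm B x + nrm B y"
    and nrm_smult: "x \<in> carrier B \<Longrightarrow> nrm B (c \<odot> x) = cmod c * nrm B x"
    and nrm_mult: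
      "\<lbrakk>x \<in> carrier B; y \<in> carrier B\<rbrakk> \<Longrightarrow> nrm B (x \<otimes> y) \<le> nrm B x * nrm B y"
    and nrm_cstar: "x \<in> carrier B \<Longrightarrow> nrm B (adj B x \<otimes> x) = (nrm B x)\<^sup>2"
    and complete: "Metric_space.mcomplete (carrier B) (nrm_dist B)"

definition unital_cstar_subalgebra :: "('a, 'm) star_algebra_scheme \<Rightarrow> 'a set \<Rightarrow> bool" where
  "unital_cstar_subalgebra B C \<longleftrightarrow>
     C \<subseteq> carrier B \<and> \<zero>\<^bsub>B\<^esub> \<in> C \<and> \<one>\<^bsub>B\<^esub> \<in> C \<and>
     (\<forall>x\<in>C. \<forall>y\<in>C. x \<oplus>\<^bsub>B\<^esub> y \<in> C \<and> x \<otimes>\<^bsub>B\<^esub> y \<in> C) \<and>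
     (\<forall>c. \<forall>x\<in>C. c \<odot>\<^bsub>B\<^esub> x \<in> C) \<and>
     (\<forall>x\<in>C. adj B x \<in> C) \<and>
     closedin (Metric_space.mtopology (carrier B) (nrm_dist B)) C"

definition positive_elements :: "('a, 'm) star_algebra_scheme \<Rightarrow> 'a set" where
  "positive_elements B = {adj B b \<otimes>\<^bsub>B\<^esub> b | b. b \<in> carrier B}"


section \<open>Conditional expectations and index-finite type\<close>

text \<open>A conditional expectation of \<open>B\<close> onto \<open>C\<close> is a positive linear projection onto \<open>C\<close> which
  is a \<open>C\<close>-bimodule map. Only the values of \<open>E\<close> on the carrier of \<open>B\<close> matter.\<close>

definition conditional_expectation ::
    "('a, 'm) star_algebra_scheme \<Rightarrow> 'a set \<Rightarrow> ('a \<Rightarrow> 'a) \<Rightarrow> bool" where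
  "conditional_expectation B C E \<longleftrightarrow>
     E ` carrier B \<subseteq> C \<and>
     (\<forall>c\<in>C. E c = c) \<and>
     (\<forall>x\<in>carrier B. \<forall>y\<in>carrier B. E (x \<oplus>\<^bsub>B\<^esub> y) = E x \<oplus>\<^bsub>B\<^esub> E y) \<and>
     (\<forall>z. \<forall>x\<in>carrier B. E (z \<odot>\<^bsub>B\<^esub> x) = z \<odot>\<^bsub>B\<^esub> E x) \<and>
     (\<forall>x\<in>positive_elements B. E x \<in> positive_elements B) \<and>
     (\<forall>c\<in>C. \<forall>d\<in>C. \<forall>x\<in>carrier B. E (c \<otimes>\<^bsub>B\<^esub> x \<otimes>\<^bsub>B\<^esub> d) = c \<otimes>\<^bsub>B\<^esub> E x \<otimes>\<^bsub>B\<^esub> d)"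

definition faithful_conditional_expectation ::
    "('a, 'm) star_algebra_scheme \<Rightarrow> 'a set \<Rightarrow> ('a \<Rightarrow> 'a) \<Rightarrow> bool" where
  "faithful_conditional_expectation B C E \<longleftrightarrow>
     conditional_expectation B C E \<and>
     (\<forall>x\<in>positive_elements B. E x = \<zero>\<^bsub>B\<^esub> \<longrightarrow> x = \<zero>\<^bsub>B\<^esub>)"

text \<open>\<open>quasi_basis B E n v\<close>: the family of pairs of \<open>v i\<close> and its adjoint, for \<open>i\<close> from 1 to \<open>n\<close>,
  is a quasi-basis for \<open>E\<close>.\<close>

definition quasi_basis ::
    "('a, 'm) star_algebra_scheme \<Rightarrow> ('a \<Rightarrow> 'a) \<Rightarrow> nat \<Rightarrow> (nat \<Rightarrow> 'a) \<Rightarrow> bool" where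
  "quasi_basis B E n v \<longleftrightarrow>
     (\<forall>i\<in>{1..n}. v i \<in> carrier B) \<and>
     (\<forall>b\<in>carrier B.
        b = (\<Oplus>\<^bsub>B\<^esub>i\<in>{1..n}. E (b \<otimes>\<^bsub>B\<^esub> v i) \<otimes>\<^bsub>B\<^esub> adj B (v i)) \<and>
        b = (\<Oplus>\<^bsub>B\<^esub>i\<in>{1..n}. v i \<otimes>\<^bsub>B\<^esub> E (adj B (v i) \<otimes>\<^bsub>B\<^esub> b)))"

definition index_finite_type ::
    "('a, 'm) star_algebra_scheme \<Rightarrow> 'a set \<Rightarrow> ('a \<Rightarrow> 'a) \<Rightarrow> bool" where
  "index_finite_type B C E \<longleftrightarrow>
     unital_cstar_algebra B \<and> unital_cstar_subalgebra B C \<and>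
     faithful_conditional_expectation B C E \<and>
     (\<exists>n v. quasi_basis B E n v)"

definition Index :: "('a, 'm) star_algebra_scheme \<Rightarrow> ('a \<Rightarrow> 'a) \<Rightarrow> 'a" where
  "Index B E =
     (THE z. \<exists>n v. quasi_basis B E n v \<and> z = (\<Oplus>\<^bsub>B\<^esub>i\<in>{1..n}. v i \<otimes>\<^bsub>B\<^esub> adj B (v i)))"


section \<open>The algebra of continuous functions\<close>

text \<open>The elements of \<open>C(X)\<close> are the continuous complex functions on the space, normalised to be
  \<open>undefined\<close> outside it. The norm is the supremum norm; the inserted 0 only matters for
  empty \<open>X\<close>, where it makes the norm 0.\<close>

definition cont_algebra :: "'x topology \<Rightarrow> ('x \<Rightarrow> complex) star_algebra" where
  "cont_algebra X =
     \<lparr>carrier = {f \<in> extensional (topspace X). continuous_map X euclidean f},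
      mult = (\<lambda>f g. \<lambda>x\<in>topspace X. f x * g x),
      one = (\<lambda>x\<in>topspace X. 1),
      zero = (\<lambda>x\<in>topspace X. 0),
      add = (\<lambda>f g. \<lambda>x\<in>topspace X. f x + g x),
      smult = (\<lambda>c f. \<lambda>x\<in>topspace X. c * f x),
      adj = (\<lambda>f. \<lambda>x\<in>topspace X. cnj (f x)),
      nrm = (\<lambda>f. Sup (insert 0 ((\<lambda>x. cmod (f x)) ` topspace X)))\<rparr>"


section \<open>Actions by homeomorphisms\<close>

definition acts_by_homeomorphisms ::
    "('g, 'm) monoid_scheme \<Rightarrow> 'x topology \<Rightarrow> ('g \<Rightarrow> 'x \<Rightarrow> 'x) \<Rightarrow> bool" where
  "acts_by_homeomorphisms G X \<phi> \<longleftrightarrow>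
     group_action G (topspace X) \<phi> \<and> (\<forall>g\<in>carrier G. homeomorphic_map X X (\<phi> g))"

definition induced_action ::
    "('g, 'm) monoid_scheme \<Rightarrow> 'x topology \<Rightarrow> ('g \<Rightarrow> 'x \<Rightarrow> 'x) \<Rightarrow>
      'g \<Rightarrow> ('x \<Rightarrow> complex) \<Rightarrow> ('x \<Rightarrow> complex)" where
  "induced_action G X \<phi> g f = (\<lambda>x\<in>topspace X. f (\<phi> (inv\<^bsub>G\<^esub> g) x))"

definition fixed_point_algebra ::
    "('g, 'm) monoid_scheme \<Rightarrow> 'x topology \<Rightarrow> ('g \<Rightarrow> 'x \<Rightarrow> 'x) \<Rightarrow> ('x \<Rightarrow> complex) set" where
  "fixed_point_algebra G X \<phi> =
     {f \<in> carrier (cont_algebra X). \<forall>g\<in>carrier G. induced_action G X \<phi> g f = f}"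

definition canonical_expectation ::
    "('g, 'm) monoid_scheme \<Rightarrow> 'x topology \<Rightarrow> ('g \<Rightarrow> 'x \<Rightarrow> 'x) \<Rightarrow>
      ('x \<Rightarrow> complex) \<Rightarrow> ('x \<Rightarrow> complex)" where
  "canonical_expectation G X \<phi> f =
     (1 / of_nat (order G)) \<odot>\<^bsub>cont_algebra X\<^esub>
       (\<Oplus>\<^bsub>cont_algebra X\<^esub>g\<in>carrier G. induced_action G X \<phi> g f)"

definition isotropy_set ::
    "('g, 'm) monoid_scheme \<Rightarrow> 'x topology \<Rightarrow> ('g \<Rightarrow> 'x \<Rightarrow> 'x) \<Rightarrow> 'g set \<Rightarrow> 'x set" where
  "isotropy_set G X \<phi> H = {x \<in> topspace X. stabilizer G \<phi> x = H}"

end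

theory Submission
  imports Defs
begin

text \<open>A family \<open>v\<close> is a quasi-basis iff its kernel \<open>K(x, y) = \<Sum>i. v i x * cnj (v i y)\<close> satisfies
  \<open>K(x, x) = |G| / |G_x|\<close> and \<open>K(x, gx) = 0\<close> whenever \<open>gx \<noteq> x\<close>: test the reconstruction formula on
  functions separating the points of the orbit of \<open>x\<close>. The diagonal of \<open>K\<close> is the index, and
  continuity of \<open>x \<mapsto> K(x, gx)\<close> forces the fixed point set of every \<open>g\<close> to be open, which is
  equivalent to closedness of all isotropy sets. Conversely, if the fixed point sets are open,
  every point has a neighbourhood \<open>U\<close> in which \<open>y, gy \<in> U\<close> only if \<open>gy = y\<close>; square roots
  of a partition of unity subordinate to such a cover, scaled by \<open>sqrt (|G| / |G_x|)\<close>, form a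
  quasi-basis.\<close>

section \<open>Continuous functions as a C*-algebra\<close>

text \<open>The space is an abstract topology, so continuity is reduced to limits at each point,
  where the limit laws of the type \<open>complex\<close> apply. The next three lemmas follow the
  same pattern.\<close>

lemma continuous_map_complex_mult:
  fixes f g :: "'x \<Rightarrow> complex"
  shows "\<lbrakk>continuous_map X euclidean f; continuous_map X euclidean g\<rbrakk>
    \<Longrightarrow> continuous_map X euclidean (\<lambda>x. f x * g x)"
  by (simp add: continuous_map_atin tendsto_mult)

lemma continuous_map_complex_cnj:
  "continuous_map X euclidean f \<Longrightarrow> continuous_map X euclidean (\<lambda>x. cnj (f x))"
  by (simp add: continuous_map_atin tendsto_cnj)

lemma continuous_map_complex_of_real:
  "continuous_map X euclideanreal f \<Longrightarrow> continuous_map X euclidean (\<lambda>x. complex_of_real (f x))"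
  by (simp add: continuous_map_atin tendsto_of_real)

lemma continuous_map_Re:
  "continuous_map X euclidean f \<Longrightarrow> continuous_map X euclideanreal (\<lambda>x. Re (f x))"
  by (simp add: continuous_map_atin tendsto_Re)

lemma continuous_map_restrict_iff:
  "continuous_map X Y (restrict f (topspace X)) \<longleftrightarrow> continuous_map X Y f"
  by (auto intro: continuous_map_eq)

section \<open>Pointwise algebra: ring, module and finite sums\<close>

lemma cont_algebra_simps:
  "carrier (cont_algebra X) = {f \<in> extensional (topspace X). continuous_map X euclidean f}"
  "f \<otimes>\<^bsub>cont_algebra X\<^esub> g = (\<lambda>x\<in>topspace X. f x * g x)"
  "\<one>\<^bsub>cont_algebra X\<^esub> = (\<lambda>x\<in>topspace X. 1)"
  "\<zero>\<^bsub>cont_algebra X\<^esub> = (\<lambda>x\<in>topspace X. 0)"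
  "f \<oplus>\<^bsub>cont_algebra X\<^esub> g = (\<lambda>x\<in>topspace X. f x + g x)"
  "c \<odot>\<^bsub>cont_algebra X\<^esub> f = (\<lambda>x\<in>topspace X. c * f x)"
  "adj (cont_algebra X) f = (\<lambda>x\<in>topspace X. cnj (f x))"
  "nrm (cont_algebra X) f = Sup (insert 0 ((\<lambda>x. cmod (f x)) ` topspace X))"
  by (simp_all add: cont_algebra_def)

lemmas cont_algebra_continuous =
  continuous_map_restrict_iff continuous_map_complex_mult continuous_map_complex_cnj
  continuous_map_complex_of_real continuous_map_add continuous_map_diff

lemma cring_complex_ring: "cring complex_ring"
proof (rule cringI)
  show "abelian_group complex_ring"
  proof (rule abelian_groupI)
    show "\<exists>y\<in>carrier complex_ring. y \<oplus>\<^bsub>complex_ring\<^esub> x = \<zero>\<^bsub>complex_ring\<^esub>" for x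
      by (rule bexI[of _ "- x"]) (simp_all add: complex_ring_def)
  qed (simp_all add: complex_ring_def)
  show "comm_monoid complex_ring"
    by (rule comm_monoidI) (simp_all add: complex_ring_def)
qed (simp_all add: complex_ring_def algebra_simps)

lemma cring_cont_algebra: "cring (cont_algebra X)"
proof (rule cringI)
  show "abelian_group (cont_algebra X)"
  proof (rule abelian_groupI)
    show "\<exists>g\<in>carrier (cont_algebra X). g \<oplus>\<^bsub>cont_algebra X\<^esub> f = \<zero>\<^bsub>cont_algebra X\<^esub>"
      if "f \<in> carrier (cont_algebra X)" for f
      using that
      by (intro bexI[of _ "\<lambda>x\<in>topspace X. - f x"])
        (auto simp: cont_algebra_simps cont_algebra_continuous)
  qed (auto simp: cont_algebra_simps cont_algebra_continuous algebra_simps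
        intro: extensionalityI)
  show "comm_monoid (cont_algebra X)"
    by (rule comm_monoidI)
      (auto simp: cont_algebra_simps cont_algebra_continuous algebra_simps intro: extensionalityI)
qed (auto simp: cont_algebra_simps algebra_simps)

lemma module_cont_algebra: "module complex_ring (cont_algebra X)"
proof (rule moduleI)
  show "abelian_group (cont_algebra X)"
    using cring_cont_algebra[of X] by (simp add: cring_def ring_def)
qed (rule cring_complex_ring, auto simp: complex_ring_def cont_algebra_simps cont_algebra_continuous
      algebra_simps intro: extensionalityI)

lemma adj_cont_algebra_closed:
  "f \<in> carrier (cont_algebra X) \<Longrightarrow> adj (cont_algebra X) f \<in> carrier (cont_algebra X)"
  by (auto simp: cont_algebra_simps cont_algebra_continuous)

lemma smult_cont_algebra_closed:
  "f \<in> carrier (cont_algebra X) \<Longrightarrow> c \<odot>\<^bsub>cont_algebra X\<^esub> f \<in> carrier (cont_algebra X)"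
  by (auto simp: cont_algebra_simps cont_algebra_continuous)

text \<open>Subtraction in a ring is defined through the additive inverse, a definite description;
  uniqueness of inverses identifies it with the pointwise negative.\<close>

lemma cont_algebra_diff:
  assumes "f \<in> carrier (cont_algebra X)" "g \<in> carrier (cont_algebra X)"
  shows "f \<ominus>\<^bsub>cont_algebra X\<^esub> g = (\<lambda>x\<in>topspace X. f x - g x)"
proof -
  interpret cring "cont_algebra X" by (rule cring_cont_algebra)
  have "(\<lambda>x\<in>topspace X. - g x) \<in> carrier (cont_algebra X)"
    using assms by (auto simp: cont_algebra_simps cont_algebra_continuous)
  moreover have "(\<lambda>x\<in>topspace X. - g x) \<oplus>\<^bsub>cont_algebra X\<^esub> g = \<zero>\<^bsub>cont_algebra X\<^esub>"
    by (auto simp: cont_algebra_simps)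
  ultimately have "\<ominus>\<^bsub>cont_algebra X\<^esub> g = (\<lambda>x\<in>topspace X. - g x)"
    using assms minus_equality by blast
  then show ?thesis
    unfolding a_minus_def by (auto simp: cont_algebra_simps)
qed

text \<open>Addition is pointwise, so induction on the index set turns the ring sum into ordinary
  sums of values. The averages over the group and the sums over quasi-bases are all evaluated this
  way.\<close>

lemma finsum_cont_algebra:
  assumes "finite I" and "\<And>i. i \<in> I \<Longrightarrow> f i \<in> carrier (cont_algebra X)"
  shows "(\<Oplus>\<^bsub>cont_algebra X\<^esub>i\<in>I. f i) = (\<lambda>x\<in>topspace X. \<Sum>i\<in>I. f i x)"
proof -
  interpret cring "cont_algebra X" by (rule cring_cont_algebra)
  show ?thesis
    using assms
  proof (induction I rule: finite_induct)
    case (insert i I)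
    then have "(\<Oplus>\<^bsub>cont_algebra X\<^esub>j\<in>insert i I. f j)
        = f i \<oplus>\<^bsub>cont_algebra X\<^esub> (\<Oplus>\<^bsub>cont_algebra X\<^esub>j\<in>I. f j)"
      by (intro finsum_insert) auto
    with insert show ?case
      by (auto simp: cont_algebra_simps)
  qed (simp add: cont_algebra_simps)
qed

section \<open>The supremum norm on a compact space and its completeness\<close>

lemma bounded_cont_algebra:
  assumes "compact_space X" "f \<in> carrier (cont_algebra X)"
  shows "bounded (f ` topspace X)"
proof -
  have "compactin euclidean (f ` topspace X)"
    using assms by (intro image_compactin[of X]) (auto simp: cont_algebra_simps compact_space_def)
  then show ?thesis
    by (simp add: compact_imp_bounded)
qed

lemma nrm_cont_algebra_bdd:
  assumes "compact_space X" "f \<in> carrier (cont_algebra X)"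
  shows "bdd_above (insert 0 ((\<lambda>x. cmod (f x)) ` topspace X))"
  using bounded_cont_algebra[OF assms] unfolding bounded_iff by (auto intro: bdd_aboveI2)

lemma nrm_cont_algebra_nonneg:
  assumes "compact_space X" "f \<in> carrier (cont_algebra X)"
  shows "0 \<le> nrm (cont_algebra X) f"
  unfolding cont_algebra_simps(8)
  by (intro cSup_upper nrm_cont_algebra_bdd assms) auto

lemma cmod_le_nrm_cont_algebra:
  assumes "compact_space X" "f \<in> carrier (cont_algebra X)" "x \<in> topspace X"
  shows "cmod (f x) \<le> nrm (cont_algebra X) f"
  unfolding cont_algebra_simps(8)
  using assms by (intro cSup_upper nrm_cont_algebra_bdd assms) auto

lemma nrm_cont_algebra_le:
  assumes "0 \<le> c" "\<And>x. x \<in> topspace X \<Longrightarrow> cmod (f x) \<le> c"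
  shows "nrm (cont_algebra X) f \<le> c"
  unfolding cont_algebra_simps(8) using assms by (intro cSup_least) auto

text \<open>Boundedness is automatic on a compact space, so C(X) is the metric space of bounded
  continuous functions; completeness will be carried over from there.\<close>

lemma carrier_cont_algebra_eq_mspace:
  assumes "compact_space X"
  shows "carrier (cont_algebra X) = mspace (cfunspace X euclidean_metric)"
  using bounded_cont_algebra[OF assms] by (auto simp: cont_algebra_simps)

text \<open>Both distances have the same upper bounds, namely the common bounds of all pointwise
  distances, and real numbers with the same upper bounds are equal.\<close>

lemma nrm_dist_cont_algebra:
  assumes "compact_space X"
    and f: "f \<in> carrier (cont_algebra X)" and g: "g \<in> carrier (cont_algebra X)"
  shows "nrm_dist (cont_algebra X) f g = mdist (cfunspace X euclidean_metric) f g"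
\<comment> \<open>On the empty space every number, even a negative one, bounds all pointwise
  distances, so the comparison of upper bounds breaks down; there both distances are 0 by
  convention.\<close>
proof (cases "topspace X = {}")
  case True
  then show ?thesis
    using f g nrm_cont_algebra_nonneg[OF \<open>compact_space X\<close>, of "f \<ominus>\<^bsub>cont_algebra X\<^esub> g"]
    by (simp add: nrm_dist_def cont_algebra_diff mdist_cfunspace_eq_mdist_funspace
        cont_algebra_simps(8))
next
  case ne: False
  interpret cring "cont_algebra X" by (rule cring_cont_algebra)
  have fg: "f \<ominus>\<^bsub>cont_algebra X\<^esub> g \<in> carrier (cont_algebra X)"
    using f g by (rule minus_closed)
  have fs: "f \<in> mspace (cfunspace X euclidean_metric)" "g \<in> mspace (cfunspace X euclidean_metric)"
    using f g carrier_cont_algebra_eq_mspace[OF assms(1)] by auto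
  have "nrm_dist (cont_algebra X) f g \<le> c \<longleftrightarrow> (\<forall>x\<in>topspace X. dist (f x) (g x) \<le> c)" for c
  proof
    assume "nrm_dist (cont_algebra X) f g \<le> c"
    then show "\<forall>x\<in>topspace X. dist (f x) (g x) \<le> c"
      using f g cmod_le_nrm_cont_algebra[OF assms(1) fg]
      by (force simp: nrm_dist_def cont_algebra_diff dist_norm)
  next
    assume c: "\<forall>x\<in>topspace X. dist (f x) (g x) \<le> c"
    with ne have "0 \<le> c"
      using zero_le_dist order_trans by blast
    with c f g show "nrm_dist (cont_algebra X) f g \<le> c"
      by (auto simp: nrm_dist_def cont_algebra_diff dist_norm intro!: nrm_cont_algebra_le)
  qed
  then have "nrm_dist (cont_algebra X) f g \<le> c
      \<longleftrightarrow> mdist (cfunspace X euclidean_metric) f g \<le> c" for c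
    unfolding cfunspace_mdist_le[OF fs ne] by simp
  then show ?thesis
    by (meson order_antisym order_refl)
qed

lemma Metric_space_cont_algebra:
  assumes "compact_space X"
  shows "Metric_space (carrier (cont_algebra X)) (nrm_dist (cont_algebra X))"
proof -
  interpret M: Metric_space "carrier (cont_algebra X)"
    "mdist (cfunspace X (euclidean_metric :: complex metric))"
    unfolding carrier_cont_algebra_eq_mspace[OF assms] by (rule Metric_space_mspace_mdist)
  note eq = nrm_dist_cont_algebra[OF assms]
  show ?thesis
  proof
    fix f g h :: "'a \<Rightarrow> complex"
    \<comment> \<open>If an argument is off the carrier, both claims come from the default value 0
      of \<open>nrm_dist\<close>.\<close>
    show "0 \<le> nrm_dist (cont_algebra X) f g" "nrm_dist (cont_algebra X) f g = nrm_dist (cont_algebra X) g f"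
      using eq[of f g] eq[of g f] M.nonneg[of f g] M.commute[of f g] by (auto simp: nrm_dist_def)
    assume f: "f \<in> carrier (cont_algebra X)" and g: "g \<in> carrier (cont_algebra X)"
    show "nrm_dist (cont_algebra X) f g = 0 \<longleftrightarrow> f = g"
      using eq[OF f g] M.zero[OF f g] by simp
    assume h: "h \<in> carrier (cont_algebra X)"
    show "nrm_dist (cont_algebra X) f h \<le> nrm_dist (cont_algebra X) f g + nrm_dist (cont_algebra X) g h"
      using M.triangle[OF f g h] by (simp add: eq f g h)
  qed
qed

text \<open>The two distances agree on the carrier: Cauchy sequences pass to the metric of bounded
  continuous functions, which is complete because \<open>complex\<close> is, and limits pass
  back.\<close>

lemma mcomplete_cont_algebra:
  assumes "compact_space X"
  shows "Metric_space.mcomplete (carrier (cont_algebra X)) (nrm_dist (cont_algebra X))"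
proof -
  let ?d = "mdist (cfunspace X (euclidean_metric :: complex metric))"
  interpret M: Metric_space "carrier (cont_algebra X)" ?d
    unfolding carrier_cont_algebra_eq_mspace[OF assms] by (rule Metric_space_mspace_mdist)
  interpret N: Metric_space "carrier (cont_algebra X)" "nrm_dist (cont_algebra X)"
    by (rule Metric_space_cont_algebra[OF assms])
  note eq = nrm_dist_cont_algebra[OF assms]
  have "Met_TC.mcomplete TYPE(complex)"
    by (simp add: complete_UNIV)
  from Met_TC.mcomplete_cfunspace[OF this, of X] have "M.mcomplete"
    unfolding Met_TC.Self_def mcomplete_of_def euclidean_metric_def[symmetric]
      carrier_cont_algebra_eq_mspace[OF assms] .
  moreover have "N.MCauchy \<sigma> \<Longrightarrow> M.MCauchy \<sigma>" for \<sigma>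
    unfolding M.MCauchy_def N.MCauchy_def by (clarsimp simp: image_subset_iff eq)
  moreover have "limitin M.mtopology \<sigma> f sequentially \<Longrightarrow> limitin N.mtopology \<sigma> f sequentially" for \<sigma> f
    unfolding M.limit_metric_sequentially N.limit_metric_sequentially using eq by metis
  ultimately show ?thesis
    unfolding M.mcomplete_def N.mcomplete_def by blast
qed

lemma unital_cstar_algebra_cont_algebra:
  assumes "compact_space X"
  shows "unital_cstar_algebra (cont_algebra X)"
proof -
  interpret C: cring "cont_algebra X" by (rule cring_cont_algebra)
  interpret module complex_ring "cont_algebra X" by (rule module_cont_algebra)
  note le = cmod_le_nrm_cont_algebra[OF assms]
  note nonneg = nrm_cont_algebra_nonneg[OF assms]
  show ?thesis
  proof unfold_locales
    fix f assume f: "f \<in> carrier (cont_algebra X)"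
    show "nrm (cont_algebra X) f = 0 \<longleftrightarrow> f = \<zero>\<^bsub>cont_algebra X\<^esub>"
    proof
      assume "nrm (cont_algebra X) f = 0"
      then have "f x = 0" if "x \<in> topspace X" for x
        using le[OF f that] by simp
      with f show "f = \<zero>\<^bsub>cont_algebra X\<^esub>"
        by (auto simp: cont_algebra_simps intro!: extensionalityI)
    next
      assume f0: "f = \<zero>\<^bsub>cont_algebra X\<^esub>"
      have "nrm (cont_algebra X) f \<le> 0"
        unfolding f0 by (rule nrm_cont_algebra_le) (auto simp: cont_algebra_simps(4))
      with nonneg[OF f] show "nrm (cont_algebra X) f = 0" by simp
    qed
    show "nrm (cont_algebra X) (c \<odot>\<^bsub>cont_algebra X\<^esub> f) = cmod c * nrm (cont_algebra X) f" for c
    proof -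
      have le1: "nrm (cont_algebra X) (c \<odot>\<^bsub>cont_algebra X\<^esub> g) \<le> cmod c * nrm (cont_algebra X) g"
        if "g \<in> carrier (cont_algebra X)" for c g
        by (rule nrm_cont_algebra_le)
           (use that in \<open>auto simp: cont_algebra_simps(6) norm_mult nonneg intro!: mult_left_mono le\<close>)
      have cf: "c \<odot>\<^bsub>cont_algebra X\<^esub> f \<in> carrier (cont_algebra X)"
        using f by (rule smult_cont_algebra_closed)
      show ?thesis
      proof (cases "c = 0")
        case True
        with le1[OF f, of c] nonneg[OF cf] show ?thesis by simp
      next
        case False
        \<comment> \<open>The bound \<open>le1\<close> is applied a second time, to the scalar
          \<open>inverse c\<close>, to obtain the reverse inequality.\<close>
        have "nrm (cont_algebra X) f = nrm (cont_algebra X) (inverse c \<odot>\<^bsub>cont_algebra X\<^esub> (c \<odot>\<^bsub>cont_algebra X\<^esub> f))"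
          using f False by (intro arg_cong[where f = "nrm (cont_algebra X)"])
            (auto simp: cont_algebra_simps intro!: extensionalityI)
        also have "\<dots> \<le> nrm (cont_algebra X) (c \<odot>\<^bsub>cont_algebra X\<^esub> f) / cmod c"
          using le1[OF cf, of "inverse c"] by (simp add: norm_inverse divide_inverse mult.commute)
        finally show ?thesis
          using le1[OF f, of c] False by (simp add: field_simps)
      qed
    qed
    show "nrm (cont_algebra X) (adj (cont_algebra X) f \<otimes>\<^bsub>cont_algebra X\<^esub> f)
      = (nrm (cont_algebra X) f)\<^sup>2"
    proof (rule antisym)
      show "nrm (cont_algebra X) (adj (cont_algebra X) f \<otimes>\<^bsub>cont_algebra X\<^esub> f) \<le> (nrm (cont_algebra X) f)\<^sup>2"
        by (rule nrm_cont_algebra_le)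
          (auto simp: cont_algebra_simps(2,7) norm_mult power2_eq_square intro!: mult_mono le nonneg f)
      have ff: "adj (cont_algebra X) f \<otimes>\<^bsub>cont_algebra X\<^esub> f \<in> carrier (cont_algebra X)"
        using f by (intro C.m_closed adj_cont_algebra_closed)
      \<comment> \<open>With a square root on the right, the supremum can be taken over the absolute
        values of f themselves; squaring is left to the end.\<close>
      have "nrm (cont_algebra X) f
          \<le> sqrt (nrm (cont_algebra X) (adj (cont_algebra X) f \<otimes>\<^bsub>cont_algebra X\<^esub> f))"
      proof (rule nrm_cont_algebra_le)
        fix x assume "x \<in> topspace X"
        with le[OF ff this] show "cmod (f x)
            \<le> sqrt (nrm (cont_algebra X) (adj (cont_algebra X) f \<otimes>\<^bsub>cont_algebra X\<^esub> f))"
          by (intro real_le_rsqrt) (simp add: cont_algebra_simps(2,7) norm_mult power2_eq_square)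
      qed (simp add: nonneg ff)
      then show "(nrm (cont_algebra X) f)\<^sup>2
          \<le> nrm (cont_algebra X) (adj (cont_algebra X) f \<otimes>\<^bsub>cont_algebra X\<^esub> f)"
        using nonneg[OF f] nonneg[OF ff] real_le_rsqrt
        by (metis real_sqrt_le_iff real_sqrt_pow2 real_sqrt_abs2 power2_eq_square abs_of_nonneg)
    qed
    fix g assume g: "g \<in> carrier (cont_algebra X)"
    show "nrm (cont_algebra X) (f \<oplus>\<^bsub>cont_algebra X\<^esub> g) \<le> nrm (cont_algebra X) f + nrm (cont_algebra X) g"
      by (rule nrm_cont_algebra_le)
        (auto simp: cont_algebra_simps(5) nonneg f g intro!: norm_triangle_mono le)
    show "nrm (cont_algebra X) (f \<otimes>\<^bsub>cont_algebra X\<^esub> g) \<le> nrm (cont_algebra X) f * nrm (cont_algebra X) g"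
      by (rule nrm_cont_algebra_le)
        (auto simp: cont_algebra_simps(2) nonneg f g norm_mult intro!: mult_mono le)
  next
    show "Metric_space.mcomplete (carrier (cont_algebra X)) (nrm_dist (cont_algebra X))"
      by (rule mcomplete_cont_algebra[OF assms])
  qed (auto simp: nonneg,  auto simp: cont_algebra_simps cont_algebra_continuous algebra_simps
      intro!: extensionalityI[of _ "topspace X"])
qed

text \<open>A nonnegative continuous function is the square of its real square root, which is again
  continuous, so positivity in the algebra is pointwise nonnegativity.\<close>

lemma positive_elements_cont_algebra:
  "f \<in> positive_elements (cont_algebra X) \<longleftrightarrow>
     f \<in> carrier (cont_algebra X) \<and> (\<forall>x\<in>topspace X. Im (f x) = 0 \<and> 0 \<le> Re (f x))"
proof (intro iffI conjI; (elim conjE)?)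
  interpret C: cring "cont_algebra X" by (rule cring_cont_algebra)
  assume "f \<in> positive_elements (cont_algebra X)"
  then obtain b where b: "b \<in> carrier (cont_algebra X)"
    and f: "f = adj (cont_algebra X) b \<otimes>\<^bsub>cont_algebra X\<^esub> b"
    by (auto simp: positive_elements_def)
  show "f \<in> carrier (cont_algebra X)"
    unfolding f by (intro C.m_closed adj_cont_algebra_closed b)
  show "\<forall>x\<in>topspace X. Im (f x) = 0 \<and> 0 \<le> Re (f x)"
    by (auto simp: f cont_algebra_simps)
next
  assume f: "f \<in> carrier (cont_algebra X)"
    and pos: "\<forall>x\<in>topspace X. Im (f x) = 0 \<and> 0 \<le> Re (f x)"
  define b where "b = (\<lambda>x\<in>topspace X. complex_of_real (sqrt (Re (f x))))"
  have "b \<in> carrier (cont_algebra X)"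
    using f by (auto simp: b_def cont_algebra_simps continuous_map_restrict_iff
        intro!: continuous_map_complex_of_real continuous_map_sqrt continuous_map_Re)
  moreover have "f = adj (cont_algebra X) b \<otimes>\<^bsub>cont_algebra X\<^esub> b"
  proof (rule extensionalityI)
    show "f \<in> extensional (topspace X)"
      using f by (simp add: cont_algebra_simps)
    show "f x = (adj (cont_algebra X) b \<otimes>\<^bsub>cont_algebra X\<^esub> b) x" if "x \<in> topspace X" for x
      using that pos
      by (simp add: b_def cont_algebra_simps complex_eq_iff flip: of_real_mult)
  qed (simp add: cont_algebra_simps)
  ultimately show "f \<in> positive_elements (cont_algebra X)"
    by (auto simp: positive_elements_def)
qed


section \<open>The canonical expectation\<close>

locale finite_homeomorphism_action = group G
  for X :: "'x topology" and G (structure) and \<phi> :: "'g \<Rightarrow> 'x \<Rightarrow> 'x" +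
  assumes compact: "compact_space X" and Hausdorff: "Hausdorff_space X"
    and finite_group: "finite (carrier G)"
    and acts: "acts_by_homeomorphisms G X \<phi>"
begin

sublocale group_action G "topspace X" \<phi>
  using acts by (simp add: acts_by_homeomorphisms_def)

abbreviation "A \<equiv> cont_algebra X"
abbreviation "E \<equiv> canonical_expectation G X \<phi>"

section \<open>Averaging over the group\<close>

lemma order_pos: "0 < order G"
  using finite_group by (simp add: order_gt_0_iff_finite)

lemma action_closed: "g \<in> carrier G \<Longrightarrow> x \<in> topspace X \<Longrightarrow> \<phi> g x \<in> topspace X"
  using element_image by blast

lemma action_continuous: "g \<in> carrier G \<Longrightarrow> continuous_map X X (\<phi> g)"
  using acts homeomorphic_imp_continuous_map by (auto simp: acts_by_homeomorphisms_def)

lemma continuous_map_action: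
  "g \<in> carrier G \<Longrightarrow> continuous_map X Y f \<Longrightarrow> continuous_map X Y (\<lambda>x. f (\<phi> g x))"
  using continuous_map_compose[OF action_continuous] by (simp add: o_def)

lemma action_one: "x \<in> topspace X \<Longrightarrow> \<phi> \<one> x = x"
  using id_eq_one by (metis restrict_apply')

lemma induced_action_closed:
  "g \<in> carrier G \<Longrightarrow> f \<in> carrier A \<Longrightarrow> induced_action G X \<phi> g f \<in> carrier A"
  using continuous_map_action[of "inv g" euclidean f]
  by (simp add: induced_action_def cont_algebra_simps continuous_map_restrict_iff)

text \<open>Inversion permutes the group, so the inverse in the induced action disappears from the
  average.\<close>

lemma expectation_eq:
  assumes "f \<in> carrier A"
  shows "E f = (\<lambda>x\<in>topspace X. (\<Sum>g\<in>carrier G. f (\<phi> g x)) / of_nat (order G))"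
proof -
  have "(\<Sum>g\<in>carrier G. f (\<phi> (inv g) x)) = (\<Sum>g\<in>carrier G. f (\<phi> g x))" for x
    by (rule sum.reindex_bij_witness[of _ "\<lambda>g. inv g" "\<lambda>g. inv g"]) auto
  moreover have "E f = (\<lambda>x\<in>topspace X. (\<Sum>g\<in>carrier G. f (\<phi> (inv g) x)) / of_nat (order G))"
    unfolding canonical_expectation_def
    by (subst finsum_cont_algebra[OF finite_group induced_action_closed[OF _ assms]])
      (auto simp: cont_algebra_simps induced_action_def)
  ultimately show ?thesis
    by simp
qed

lemma expectation_closed:
  assumes "f \<in> carrier A"
  shows "E f \<in> carrier A"
proof -
  have "continuous_map X euclidean (\<lambda>x. (\<Sum>g\<in>carrier G. f (\<phi> g x)) * (1 / of_nat (order G)))"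
    using assms
    by (intro continuous_map_complex_mult continuous_map_sum finite_group continuous_map_canonical_const)
      (auto simp: cont_algebra_simps intro: continuous_map_action[of _ _ f])
  then show ?thesis
    by (simp add: expectation_eq[OF assms] cont_algebra_simps continuous_map_restrict_iff)
qed

text \<open>The inverse of g runs over the whole group together with g, so invariance can be
  expressed by g itself: the fixed functions are those constant along orbits.\<close>

lemma mem_fixed_point_algebra_iff:
  "f \<in> fixed_point_algebra G X \<phi> \<longleftrightarrow>
     f \<in> carrier A \<and> (\<forall>g\<in>carrier G. \<forall>x\<in>topspace X. f (\<phi> g x) = f x)"
proof (intro iffI conjI ballI; (elim conjE)?)
  fix g x assume f: "f \<in> fixed_point_algebra G X \<phi>" and g: "g \<in> carrier G" and x: "x \<in> topspace X"
  then have "induced_action G X \<phi> (inv g) f = f"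
    by (auto simp: fixed_point_algebra_def)
  then show "f (\<phi> g x) = f x"
    using g x unfolding induced_action_def by (metis inv_inv restrict_apply')
next
  assume "f \<in> carrier A" and inv: "\<forall>g\<in>carrier G. \<forall>x\<in>topspace X. f (\<phi> g x) = f x"
  then show "f \<in> fixed_point_algebra G X \<phi>"
    by (auto simp: fixed_point_algebra_def induced_action_def cont_algebra_simps
        intro!: extensionalityI[of _ "topspace X"])
qed (simp add: fixed_point_algebra_def)

text \<open>Right translation by a group element permutes the summands of the average.\<close>

lemma expectation_mem_fixed_point_algebra:
  assumes f: "f \<in> carrier A"
  shows "E f \<in> fixed_point_algebra G X \<phi>"
  unfolding mem_fixed_point_algebra_iff
proof (intro conjI ballI expectation_closed f)
  fix h x assume h: "h \<in> carrier G" and x: "x \<in> topspace X"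
  have "(\<Sum>g\<in>carrier G. f (\<phi> g (\<phi> h x))) = (\<Sum>g\<in>carrier G. f (\<phi> (g \<otimes> h) x))"
    using h x by (intro sum.cong) (simp_all add: composition_rule)
  also have "\<dots> = (\<Sum>g\<in>carrier G. f (\<phi> g x))"
    using h by (intro sum.reindex_bij_witness[of _ "\<lambda>g. g \<otimes> inv h" "\<lambda>g. g \<otimes> h"])
      (auto simp: m_assoc)
  finally show "E f (\<phi> h x) = E f x"
    using h x by (simp add: expectation_eq f action_closed)
qed

text \<open>The algebraic closure properties are pointwise. For norm closedness, a function that
  differs at x and gx has a whole ball of functions around it that are not invariant.\<close>

lemma unital_cstar_subalgebra_fixed_point_algebra:
  "unital_cstar_subalgebra A (fixed_point_algebra G X \<phi>)"
proof -
  interpret C: cring A by (rule cring_cont_algebra)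
  interpret Metric_space "carrier A" "nrm_dist A"
    by (rule Metric_space_cont_algebra[OF compact])
  have "closedin mtopology (fixed_point_algebra G X \<phi>)"
    unfolding closedin_metric
  proof (intro conjI allI impI)
    show "fixed_point_algebra G X \<phi> \<subseteq> carrier A"
      by (auto simp: mem_fixed_point_algebra_iff)
    fix f assume f: "f \<in> carrier A - fixed_point_algebra G X \<phi>"
    then obtain g x where g: "g \<in> carrier G" and x: "x \<in> topspace X" and ne: "f (\<phi> g x) \<noteq> f x"
      by (auto simp: mem_fixed_point_algebra_iff)
    \<comment> \<open>Half the gap: an invariant function closer than r to f at both points would
      make the gap smaller than itself.\<close>
    define r where "r = cmod (f (\<phi> g x) - f x) / 2"
    have "h \<notin> mball f r" if "h \<in> fixed_point_algebra G X \<phi>" for h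
    proof
      assume h: "h \<in> mball f r"
      have hinv: "h (\<phi> g x) = h x" and hA: "h \<in> carrier A"
        using that g x by (auto simp: mem_fixed_point_algebra_iff)
      have lt: "cmod (f y - h y) < r" if "y \<in> topspace X" for y
      proof -
        have "f \<ominus>\<^bsub>A\<^esub> h \<in> carrier A"
          using f hA by (intro C.minus_closed) auto
        from cmod_le_nrm_cont_algebra[OF compact this that]
        have "cmod (f y - h y) \<le> nrm A (f \<ominus>\<^bsub>A\<^esub> h)"
          using that f hA by (simp add: cont_algebra_diff)
        also have "\<dots> < r"
          using h hA by (auto simp: nrm_dist_def)
        finally show ?thesis .
      qed
      have "cmod (f (\<phi> g x) - f x) \<le> cmod (f (\<phi> g x) - h (\<phi> g x)) + cmod (f x - h x)"
        using norm_triangle_ineq4[of "f (\<phi> g x) - h (\<phi> g x)" "f x - h x"] hinv by simp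
      also have "\<dots> < 2 * r"
        using lt[OF x] lt[OF action_closed[OF g x]] by simp
      finally show False by (simp add: r_def)
    qed
    moreover have "0 < r"
      using ne by (simp add: r_def)
    ultimately show "\<exists>r>0. disjnt (fixed_point_algebra G X \<phi>) (mball f r)"
      by (auto simp: disjnt_iff)
  qed
  then show ?thesis
    unfolding unital_cstar_subalgebra_def
    by (simp add: mem_fixed_point_algebra_iff adj_cont_algebra_closed smult_cont_algebra_closed
        subset_iff) (auto simp: mem_fixed_point_algebra_iff action_closed cont_algebra_simps(2-7))
qed

text \<open>Every property is verified at a point. The bimodule property holds because invariant
  factors are constant along the orbit and can be taken out of the average.\<close>

lemma faithful_conditional_expectation_expectation:
  "faithful_conditional_expectation A (fixed_point_algebra G X \<phi>) E"
proof -
  interpret C: cring A by (rule cring_cont_algebra)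
  have ext: "f = h" if "f \<in> carrier A" "h \<in> carrier A" "\<And>x. x \<in> topspace X \<Longrightarrow> f x = h x" for f h
    using that by (auto simp: cont_algebra_simps intro: extensionalityI)
  have proj: "E f = f" if "f \<in> fixed_point_algebra G X \<phi>" for f
  proof -
    have f: "f \<in> carrier A" and "\<And>g x. g \<in> carrier G \<Longrightarrow> x \<in> topspace X \<Longrightarrow> f (\<phi> g x) = f x"
      using that by (auto simp: mem_fixed_point_algebra_iff)
    then show ?thesis
      using order_pos by (intro ext expectation_closed) (simp_all add: expectation_eq order_def)
  qed
  have add: "E (f \<oplus>\<^bsub>A\<^esub> h) = E f \<oplus>\<^bsub>A\<^esub> E h" if "f \<in> carrier A" "h \<in> carrier A" for f h
    using that
    by (intro ext expectation_closed C.a_closed)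
      (simp_all add: expectation_eq C.a_closed, simp add: cont_algebra_simps action_closed sum.distrib
        add_divide_distrib)
  have smult: "E (z \<odot>\<^bsub>A\<^esub> f) = z \<odot>\<^bsub>A\<^esub> E f" if "f \<in> carrier A" for z f
    using that
    by (intro ext expectation_closed smult_cont_algebra_closed)
      (simp_all add: expectation_eq smult_cont_algebra_closed,
        simp add: cont_algebra_simps action_closed sum_distrib_left)
  have pos: "E f \<in> positive_elements A" if "f \<in> positive_elements A" for f
  proof -
    have "f \<in> carrier A"
      using that by (simp add: positive_elements_cont_algebra)
    with that show ?thesis
      unfolding positive_elements_cont_algebra
      by (intro conjI expectation_closed)
        (auto simp: expectation_eq action_closed intro!: sum_nonneg divide_nonneg_nonneg)
  qed
  have bimod: "E (c \<otimes>\<^bsub>A\<^esub> f \<otimes>\<^bsub>A\<^esub> d) = c \<otimes>\<^bsub>A\<^esub> E f \<otimes>\<^bsub>A\<^esub> d"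
    if c: "c \<in> fixed_point_algebra G X \<phi>" and d: "d \<in> fixed_point_algebra G X \<phi>"
      and f: "f \<in> carrier A" for c d f
  proof -
    have cd: "c \<in> carrier A" "d \<in> carrier A"
      using c d by (auto simp: mem_fixed_point_algebra_iff)
    show ?thesis
    proof (intro ext expectation_closed C.m_closed f cd)
      fix x assume x: "x \<in> topspace X"
      have "E (c \<otimes>\<^bsub>A\<^esub> f \<otimes>\<^bsub>A\<^esub> d) x
          = (\<Sum>g\<in>carrier G. c (\<phi> g x) * f (\<phi> g x) * d (\<phi> g x)) / of_nat (order G)"
        using x f cd by (simp add: expectation_eq C.m_closed)
          (simp add: cont_algebra_simps action_closed)
      also have "(\<Sum>g\<in>carrier G. c (\<phi> g x) * f (\<phi> g x) * d (\<phi> g x))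
          = (\<Sum>g\<in>carrier G. c x * f (\<phi> g x) * d x)"
        using c d x by (intro sum.cong) (auto simp: mem_fixed_point_algebra_iff)
      also have "\<dots> / of_nat (order G) = (c \<otimes>\<^bsub>A\<^esub> E f \<otimes>\<^bsub>A\<^esub> d) x"
        using x f by (simp add: expectation_eq)
          (simp add: cont_algebra_simps sum_distrib_left sum_distrib_right)
      finally show "E (c \<otimes>\<^bsub>A\<^esub> f \<otimes>\<^bsub>A\<^esub> d) x = (c \<otimes>\<^bsub>A\<^esub> E f \<otimes>\<^bsub>A\<^esub> d) x" .
    qed
  qed
  have faithful: "f = \<zero>\<^bsub>A\<^esub>" if f: "f \<in> positive_elements A" and E0: "E f = \<zero>\<^bsub>A\<^esub>" for f
  proof (rule ext)
    show fA: "f \<in> carrier A"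
      using f by (simp add: positive_elements_cont_algebra)
    fix x assume x: "x \<in> topspace X"
    have "Re (E f x) = 0"
      using x by (simp add: E0 cont_algebra_simps)
    then have "(\<Sum>g\<in>carrier G. Re (f (\<phi> g x))) = 0"
      using x order_pos by (simp add: expectation_eq[OF fA] Re_divide_of_nat)
    moreover have "0 \<le> Re (f (\<phi> g x))" if "g \<in> carrier G" for g
      using f action_closed[OF that x] by (simp add: positive_elements_cont_algebra)
    \<comment> \<open>A vanishing sum of nonnegative terms has only zero terms; the term of the
      identity is the value at x.\<close>
    ultimately have "Re (f (\<phi> \<one> x)) = 0"
      by (simp add: sum_nonneg_eq_0_iff finite_group)
    then show "f x = \<zero>\<^bsub>A\<^esub> x"
      using f x by (simp add: action_one positive_elements_cont_algebra cont_algebra_simps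
          complex_eq_iff)
  qed simp
  show ?thesis
    unfolding faithful_conditional_expectation_def conditional_expectation_def
    by (intro conjI ballI allI impI image_subsetI;
      rule expectation_mem_fixed_point_algebra proj add smult pos bimod faithful; assumption)
qed


section \<open>Quasi-bases and isotropy\<close>

lemma card_stabilizer_pos:
  "x \<in> topspace X \<Longrightarrow> 0 < card (stabilizer G \<phi> x)"
  using stabilizer_one_closed finite_subset[OF stabilizer_subset finite_group]
  by (auto simp: card_gt_0_iff)

text \<open>The Gram kernel of the vectors with entries \<open>v i x\<close>. It is Hermitian and
  contains all the information about the family that the reconstruction formulas and the index
  use.\<close>

definition kernel :: "nat \<Rightarrow> (nat \<Rightarrow> 'x \<Rightarrow> complex) \<Rightarrow> 'x \<Rightarrow> 'x \<Rightarrow> complex" where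
  "kernel n v x y = (\<Sum>i\<in>{1..n}. v i x * cnj (v i y))"

lemma cnj_kernel: "cnj (kernel n v x y) = kernel n v y x"
  by (simp add: kernel_def mult.commute)

text \<open>Exchanging the sum over the family with the average over the group leaves only values of
  the kernel at pairs of points of one orbit.\<close>

lemma finsum_quasi_basis:
  assumes v: "\<forall>i\<in>{1..n}. v i \<in> carrier A" and b: "b \<in> carrier A"
  shows "(\<Oplus>\<^bsub>A\<^esub>i\<in>{1..n}. E (b \<otimes>\<^bsub>A\<^esub> v i) \<otimes>\<^bsub>A\<^esub> adj A (v i))
      = (\<lambda>x\<in>topspace X. (\<Sum>g\<in>carrier G. b (\<phi> g x) * kernel n v (\<phi> g x) x) / of_nat (order G))"
    and "(\<Oplus>\<^bsub>A\<^esub>i\<in>{1..n}. v i \<otimes>\<^bsub>A\<^esub> E (adj A (v i) \<otimes>\<^bsub>A\<^esub> b))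
      = (\<lambda>x\<in>topspace X. (\<Sum>g\<in>carrier G. kernel n v x (\<phi> g x) * b (\<phi> g x)) / of_nat (order G))"
proof -
  interpret C: cring A by (rule cring_cont_algebra)
  note [simp] = bspec[OF v] b C.m_closed expectation_closed adj_cont_algebra_closed
  show "(\<Oplus>\<^bsub>A\<^esub>i\<in>{1..n}. E (b \<otimes>\<^bsub>A\<^esub> v i) \<otimes>\<^bsub>A\<^esub> adj A (v i))
      = (\<lambda>x\<in>topspace X. (\<Sum>g\<in>carrier G. b (\<phi> g x) * kernel n v (\<phi> g x) x) / of_nat (order G))"
    (is "?l = ?r")
  proof -
    have "?l = (\<lambda>x\<in>topspace X. \<Sum>i\<in>{1..n}. (E (b \<otimes>\<^bsub>A\<^esub> v i) \<otimes>\<^bsub>A\<^esub> adj A (v i)) x)"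
      by (intro finsum_cont_algebra) simp_all
    also have "\<dots> = (\<lambda>x\<in>topspace X. \<Sum>i\<in>{1..n}.
        (\<Sum>g\<in>carrier G. b (\<phi> g x) * v i (\<phi> g x)) / of_nat (order G) * cnj (v i x))"
      by (intro restrict_ext sum.cong refl)
        (simp add: expectation_eq, simp add: cont_algebra_simps action_closed)
    also have "\<dots> = ?r"
      by (intro restrict_ext) (simp add: kernel_def sum_distrib_left sum_distrib_right
          sum_divide_distrib mult.assoc sum.swap[of _ "carrier G"])
    finally show ?thesis .
  qed
  show "(\<Oplus>\<^bsub>A\<^esub>i\<in>{1..n}. v i \<otimes>\<^bsub>A\<^esub> E (adj A (v i) \<otimes>\<^bsub>A\<^esub> b))
      = (\<lambda>x\<in>topspace X. (\<Sum>g\<in>carrier G. kernel n v x (\<phi> g x) * b (\<phi> g x)) / of_nat (order G))"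
    (is "?l = ?r")
  proof -
    have "?l = (\<lambda>x\<in>topspace X. \<Sum>i\<in>{1..n}. (v i \<otimes>\<^bsub>A\<^esub> E (adj A (v i) \<otimes>\<^bsub>A\<^esub> b)) x)"
      by (intro finsum_cont_algebra) simp_all
    also have "\<dots> = (\<lambda>x\<in>topspace X. \<Sum>i\<in>{1..n}.
        v i x * ((\<Sum>g\<in>carrier G. cnj (v i (\<phi> g x)) * b (\<phi> g x)) / of_nat (order G)))"
      by (intro restrict_ext sum.cong refl)
        (simp add: expectation_eq, simp add: cont_algebra_simps action_closed)
    also have "\<dots> = ?r"
      by (intro restrict_ext) (simp add: kernel_def sum_distrib_left sum_distrib_right
          sum_divide_distrib mult.assoc sum.swap[of _ "carrier G"])
    finally show ?thesis .
  qed
qed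

lemma finsum_mult_adj:
  assumes "\<forall>i\<in>{1..n}. v i \<in> carrier A"
  shows "(\<Oplus>\<^bsub>A\<^esub>i\<in>{1..n}. v i \<otimes>\<^bsub>A\<^esub> adj A (v i)) = (\<lambda>x\<in>topspace X. kernel n v x x)"
proof -
  interpret C: cring A by (rule cring_cont_algebra)
  have "(\<Oplus>\<^bsub>A\<^esub>i\<in>{1..n}. v i \<otimes>\<^bsub>A\<^esub> adj A (v i))
      = (\<lambda>x\<in>topspace X. \<Sum>i\<in>{1..n}. (v i \<otimes>\<^bsub>A\<^esub> adj A (v i)) x)"
    using assms by (intro finsum_cont_algebra C.m_closed adj_cont_algebra_closed) simp_all
  also have "\<dots> = (\<lambda>x\<in>topspace X. kernel n v x x)"
    by (intro restrict_ext) (simp add: kernel_def cont_algebra_simps(2,7))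
  finally show ?thesis .
qed

section \<open>Separation of orbit points and the kernel criterion\<close>

lemma completely_regular: "completely_regular_space X"
  using compact Hausdorff compact_Hausdorff_or_regular_imp_normal_space
    normal_imp_completely_regular_space by blast

text \<open>Finite sets are closed in a Hausdorff space, so complete regularity applies. It serves
  to isolate one point of an orbit from the others.\<close>

lemma exists_separating_function:
  assumes "finite S" "S \<subseteq> topspace X" "y \<in> topspace X" "y \<notin> S"
  obtains b where "b \<in> carrier A" "b y = 1" "\<And>z. z \<in> S \<Longrightarrow> b z = 0"
proof -
  have "closedin X S"
    using assms Hausdorff by (simp add: closedin_Hausdorff_finite)
  then obtain f :: "'x \<Rightarrow> real" where f: "continuous_map X euclidean f" "f y = 1" "f ` S \<subseteq> {0}"
    using completely_regular assms
    unfolding completely_regular_space_gen_alt[of 1 "0 :: real" X, OF one_neq_zero] by blast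
  show ?thesis
  proof (rule that[of "\<lambda>x\<in>topspace X. complex_of_real (f x)"])
    show "(\<lambda>x\<in>topspace X. complex_of_real (f x)) \<in> carrier A"
      using f by (simp add: cont_algebra_simps cont_algebra_continuous)
  qed (use assms f in auto)
qed

text \<open>In one direction, a test function that is 1 at a single orbit point and 0 at the others
  picks out one kernel value. In the other, only the stabiliser contributes to the average, and its
  order cancels the denominator of the prescribed diagonal value.\<close>

lemma quasi_basis_iff:
  "quasi_basis A E n v \<longleftrightarrow>
    (\<forall>i\<in>{1..n}. v i \<in> carrier A) \<and>
    (\<forall>x\<in>topspace X. \<forall>g\<in>carrier G. kernel n v x (\<phi> g x)
      = (if \<phi> g x = x then of_nat (order G) / of_nat (card (stabilizer G \<phi> x)) else 0))"
  (is "_ \<longleftrightarrow> ?V \<and> ?K")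
proof (intro iffI conjI ballI; (elim conjE)?)
  fix x h assume Q: "quasi_basis A E n v" and x: "x \<in> topspace X" and h: "h \<in> carrier G"
  have v: "\<forall>i\<in>{1..n}. v i \<in> carrier A"
    using Q by (auto simp: quasi_basis_def)
  let ?y = "\<phi> h x"
  have fin: "finite ((\<lambda>g. \<phi> g x) ` carrier G - {?y})"
    by (simp add: finite_group)
  obtain b where b: "b \<in> carrier A" and b1: "b ?y = 1"
    and b0: "\<And>z. z \<in> (\<lambda>g. \<phi> g x) ` carrier G - {?y} \<Longrightarrow> b z = 0"
    using exists_separating_function[OF fin, of ?y] x h action_closed by blast
  have "b = (\<lambda>x\<in>topspace X.
      (\<Sum>g\<in>carrier G. kernel n v x (\<phi> g x) * b (\<phi> g x)) / of_nat (order G))"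
    using Q b unfolding finsum_quasi_basis(2)[OF v b, symmetric] quasi_basis_def by blast
  from fun_cong[OF this, of x]
  have "b x = (\<Sum>g\<in>carrier G. kernel n v x (\<phi> g x) * b (\<phi> g x)) / of_nat (order G)"
    using x by simp
  also have "(\<Sum>g\<in>carrier G. kernel n v x (\<phi> g x) * b (\<phi> g x))
      = (\<Sum>g\<in>carrier G. if \<phi> g x = ?y then kernel n v x ?y else 0)"
    using b1 b0 by (intro sum.cong) auto
  also have "\<dots> = of_nat (card {g \<in> carrier G. \<phi> g x = ?y}) * kernel n v x ?y"
    using finite_group by (simp add: sum.If_cases Int_def)
  \<comment> \<open>The factor counts the group elements carrying x to \<open>?y\<close>. For
    \<open>?y = x\<close> it is the order of the stabiliser; otherwise it only matters that it is
    not 0, since h is counted.\<close>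
  finally have bx: "of_nat (order G) * b x
      = of_nat (card {g \<in> carrier G. \<phi> g x = ?y}) * kernel n v x ?y"
    using order_pos by simp
  show "kernel n v x ?y
      = (if ?y = x then of_nat (order G) / of_nat (card (stabilizer G \<phi> x)) else 0)"
  proof (cases "?y = x")
    case True
    with bx b1 card_stabilizer_pos[OF x] show ?thesis
      by (simp add: stabilizer_def field_simps)
  next
    case False
    have "b x = 0"
      using False x by (intro b0) (auto intro!: image_eqI[of _ _ \<one>] simp: action_one)
    moreover have "card {g \<in> carrier G. \<phi> g x = ?y} \<noteq> 0"
      using h finite_group by auto
    ultimately show ?thesis
      using bx False by simp
  qed
next
  assume v: ?V and K: ?K
  have sum: "(\<Sum>g\<in>carrier G. b (\<phi> g x) * kernel n v x (\<phi> g x)) / of_nat (order G) = b x"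
    if x: "x \<in> topspace X" for b :: "'x \<Rightarrow> complex" and x
  proof -
    have "(\<Sum>g\<in>carrier G. b (\<phi> g x) * kernel n v x (\<phi> g x))
        = (\<Sum>g\<in>carrier G. if \<phi> g x = x
            then b x * (of_nat (order G) / of_nat (card (stabilizer G \<phi> x))) else 0)"
      using K x by (intro sum.cong) auto
    also have "\<dots> = of_nat (card (stabilizer G \<phi> x))
        * (b x * (of_nat (order G) / of_nat (card (stabilizer G \<phi> x))))"
      using finite_group by (simp add: sum.If_cases Int_def stabilizer_def)
    finally show ?thesis
      using card_stabilizer_pos[OF x] order_pos by simp
  qed
  \<comment> \<open>The prescribed values are real, so Hermitian symmetry becomes symmetry, and one
    computation serves both reconstruction formulas.\<close>
  have sym: "kernel n v (\<phi> g x) x = kernel n v x (\<phi> g x)"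
    if "x \<in> topspace X" "g \<in> carrier G" for x g
  proof -
    have "kernel n v (\<phi> g x) x = cnj (kernel n v x (\<phi> g x))"
      by (simp add: cnj_kernel)
    then show ?thesis
      using K that by simp
  qed
  show "quasi_basis A E n v"
    unfolding quasi_basis_def
  proof (intro conjI ballI)
    fix b assume b: "b \<in> carrier A"
    have bE: "b = (\<lambda>x\<in>topspace X. b x)"
      using b by (simp add: cont_algebra_simps extensional_restrict)
    show "b = (\<Oplus>\<^bsub>A\<^esub>i\<in>{1..n}. E (b \<otimes>\<^bsub>A\<^esub> v i) \<otimes>\<^bsub>A\<^esub> adj A (v i))"
      unfolding finsum_quasi_basis(1)[OF v b]
      by (subst bE, rule restrict_ext) (simp add: sym sum cong: sum.cong)
    show "b = (\<Oplus>\<^bsub>A\<^esub>i\<in>{1..n}. v i \<otimes>\<^bsub>A\<^esub> E (adj A (v i) \<otimes>\<^bsub>A\<^esub> b))"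
      unfolding finsum_quasi_basis(2)[OF v b]
      by (subst bE, rule restrict_ext) (simp add: sum mult.commute[of "kernel _ _ _ _"])
  qed (use v in blast)
qed (simp add: quasi_basis_def)

text \<open>The sum defining the index is the diagonal of the kernel, and the kernel criterion
  forces its values. The same value for every quasi-basis is the uniqueness that the definite
  description in \<open>Index\<close> asks for.\<close>

lemma Index_eq:
  assumes "quasi_basis A E n v"
  shows "Index A E = (\<lambda>x\<in>topspace X. of_nat (order G) / of_nat (card (stabilizer G \<phi> x)))"
proof -
  have index: "(\<Oplus>\<^bsub>A\<^esub>i\<in>{1..m}. w i \<otimes>\<^bsub>A\<^esub> adj A (w i))
      = (\<lambda>x\<in>topspace X. of_nat (order G) / of_nat (card (stabilizer G \<phi> x)))"
    if Q: "quasi_basis A E m w" for m w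
  proof -
    have w: "\<forall>i\<in>{1..m}. w i \<in> carrier A"
      and K: "\<And>x g. x \<in> topspace X \<Longrightarrow> g \<in> carrier G \<Longrightarrow> kernel m w x (\<phi> g x)
        = (if \<phi> g x = x then of_nat (order G) / of_nat (card (stabilizer G \<phi> x)) else 0)"
      using Q unfolding quasi_basis_iff by auto
    have "kernel m w x x = of_nat (order G) / of_nat (card (stabilizer G \<phi> x))"
      if "x \<in> topspace X" for x
      using K[OF that one_closed] by (simp add: action_one that)
    then show ?thesis
      unfolding finsum_mult_adj[OF w] by (rule restrict_ext)
  qed
  show ?thesis
    unfolding Index_def
  proof (rule the_equality)
    show "\<exists>n v. quasi_basis A E n v \<and>
        (\<lambda>x\<in>topspace X. of_nat (order G) / of_nat (card (stabilizer G \<phi> x)))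
          = (\<Oplus>\<^bsub>A\<^esub>i\<in>{1..n}. v i \<otimes>\<^bsub>A\<^esub> adj A (v i))"
      by (intro exI conjI, rule assms, rule index[OF assms, symmetric])
  qed (elim exE conjE, simp only: index)
qed

text \<open>The isotropy sets are disjoint and the stabiliser of x is a subgroup, so exactly one
  summand survives.\<close>

lemma sum_indicator_isotropy_set:
  fixes c :: "'g set \<Rightarrow> complex"
  assumes "x \<in> topspace X"
  shows "(\<Sum>H | subgroup H G. c H * indicator (isotropy_set G X \<phi> H) x) = c (stabilizer G \<phi> x)"
proof -
  have "{H. subgroup H G} \<subseteq> Pow (carrier G)"
    using subgroup.subset by blast
  then have fin: "finite {H. subgroup H G}"
    using finite_group finite_subset by blast
  have "(\<Sum>H | subgroup H G. c H * indicator (isotropy_set G X \<phi> H) x)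
      = (\<Sum>H | subgroup H G. if H = stabilizer G \<phi> x then c H else 0)"
    using assms by (intro sum.cong) (auto simp: isotropy_set_def)
  also have "\<dots> = c (stabilizer G \<phi> x)"
    using fin stabilizer_subgroup[OF assms] by (simp add: sum.delta)
  finally show ?thesis .
qed

section \<open>Fixed point sets of group elements and isotropy sets\<close>

lemma closedin_invariants: "g \<in> carrier G \<Longrightarrow> closedin X (invariants (topspace X) \<phi> g)"
  unfolding invariants_def
  using closedin_continuous_maps_eq[OF Hausdorff action_continuous continuous_map_id] by simp

text \<open>The complement of the fixed point set of g is the finite union of the isotropy sets of
  the subgroups not containing g. Conversely, the isotropy set of H is the common fixed point set of
  H, always closed, minus the fixed point sets of the elements outside H.\<close>

lemma closedin_isotropy_sets_iff:
  "(\<forall>H. subgroup H G \<longrightarrow> closedin X (isotropy_set G X \<phi> H)) \<longleftrightarrow>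
    (\<forall>g\<in>carrier G. openin X (invariants (topspace X) \<phi> g))"
proof (intro iffI allI impI ballI)
  fix g assume closed: "\<forall>H. subgroup H G \<longrightarrow> closedin X (isotropy_set G X \<phi> H)"
    and g: "g \<in> carrier G"
  have "{H. subgroup H G \<and> g \<notin> H} \<subseteq> Pow (carrier G)"
    using subgroup.subset by blast
  then have "finite {H. subgroup H G \<and> g \<notin> H}"
    using finite_group finite_subset by blast
  then have "closedin X (\<Union>(isotropy_set G X \<phi> ` {H. subgroup H G \<and> g \<notin> H}))"
    using closed by (intro closedin_Union) auto
  also have "\<Union>(isotropy_set G X \<phi> ` {H. subgroup H G \<and> g \<notin> H})
      = topspace X - invariants (topspace X) \<phi> g"
    using g stabilizer_subgroup by (auto simp: isotropy_set_def invariants_def stabilizer_def)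
  finally show "openin X (invariants (topspace X) \<phi> g)"
    by (auto simp: openin_closedin_eq invariants_def)
next
  fix H assume op: "\<forall>g\<in>carrier G. openin X (invariants (topspace X) \<phi> g)"
    and H: "subgroup H G"
  \<comment> \<open>As the identity lies in H, the intersection over H below is not the empty one,
    which would be the whole type instead of a subset of the space.\<close>
  have sub: "H \<subseteq> carrier G" and one: "\<one> \<in> H"
    using H subgroup.subset subgroup.one_closed by blast+
  have "isotropy_set G X \<phi> H = (\<Inter>g\<in>H. invariants (topspace X) \<phi> g)
      - (\<Union>g\<in>carrier G - H. invariants (topspace X) \<phi> g)"
    using sub one by (auto simp: isotropy_set_def invariants_def stabilizer_def)
  moreover have "closedin X (\<Inter>g\<in>H. invariants (topspace X) \<phi> g)"
    using sub one by (intro closedin_Inter) (auto intro: closedin_invariants)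
  moreover have "openin X (\<Union>g\<in>carrier G - H. invariants (topspace X) \<phi> g)"
    using op by (intro openin_Union) auto
  ultimately show "closedin X (isotropy_set G X \<phi> H)"
    by (simp add: closedin_diff)
qed

text \<open>Along the graph of g the kernel is continuous, positive at the fixed points of g and 0
  elsewhere, so the fixed point set is the preimage of an open half-line.\<close>

lemma quasi_basis_imp_openin_invariants:
  assumes Q: "quasi_basis A E n v" and g: "g \<in> carrier G"
  shows "openin X (invariants (topspace X) \<phi> g)"
proof -
  have v: "\<forall>i\<in>{1..n}. v i \<in> carrier A"
    and K: "\<And>x. x \<in> topspace X \<Longrightarrow> kernel n v x (\<phi> g x)
        = (if \<phi> g x = x then of_nat (order G) / of_nat (card (stabilizer G \<phi> x)) else 0)"
    using Q g unfolding quasi_basis_iff by auto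
  have cont: "continuous_map X euclideanreal (\<lambda>x. Re (kernel n v x (\<phi> g x)))"
    unfolding kernel_def
    using v g
    by (intro continuous_map_Re continuous_map_sum continuous_map_complex_mult
        continuous_map_complex_cnj continuous_map_action[OF g, of _ "v _"])
      (auto simp: cont_algebra_simps)
  have "0 < Re (kernel n v x (\<phi> g x)) \<longleftrightarrow> \<phi> g x = x" if "x \<in> topspace X" for x
    using K[OF that] card_stabilizer_pos[OF that] order_pos by simp
  then have "invariants (topspace X) \<phi> g = {x \<in> topspace X. Re (kernel n v x (\<phi> g x)) \<in> {0<..}}"
    by (auto simp: invariants_def)
  then show ?thesis
    using openin_continuous_map_preimage[OF cont, of "{0<..}"] by simp
qed

section \<open>Construction of a quasi-basis from open fixed point sets\<close>

lemma exists_small_neighbourhood: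
  assumes op: "\<And>g. g \<in> carrier G \<Longrightarrow> openin X (invariants (topspace X) \<phi> g)"
    and x: "x \<in> topspace X"
  obtains U where "openin X U" "x \<in> U"
    "\<And>g y. g \<in> carrier G \<Longrightarrow> y \<in> U \<Longrightarrow> \<phi> g y \<in> U \<Longrightarrow> \<phi> g y = y"
proof -
  \<comment> \<open>One neighbourhood is found for each group element; their intersection is open
    because the group is finite. If g fixes x, the open fixed point set of g serves.\<close>
  have "\<exists>U. openin X U \<and> x \<in> U \<and> (\<forall>y\<in>U. \<phi> g y \<in> U \<longrightarrow> \<phi> g y = y)" if g: "g \<in> carrier G" for g
  proof (cases "\<phi> g x = x")
    case True
    then show ?thesis
      using op[OF g] x by (intro exI[of _ "invariants (topspace X) \<phi> g"]) (auto simp: invariants_def)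
  next
    case False
    obtain V W where VW: "openin X V" "openin X W" "x \<in> V" "\<phi> g x \<in> W" "disjnt V W"
      using Hausdorff x action_closed[OF g x] False unfolding Hausdorff_space_def by metis
    \<comment> \<open>g carries every point of this set into W, which is disjoint from V, hence out
      of the set.\<close>
    have "openin X (V \<inter> {y \<in> topspace X. \<phi> g y \<in> W})"
      using VW openin_continuous_map_preimage[OF action_continuous[OF g]] by blast
    then show ?thesis
      using VW x by (intro exI[of _ "V \<inter> {y \<in> topspace X. \<phi> g y \<in> W}"]) (auto simp: disjnt_iff)
  qed
  then obtain U where U: "\<And>g. g \<in> carrier G \<Longrightarrow> openin X (U g)" "\<And>g. g \<in> carrier G \<Longrightarrow> x \<in> U g"
    "\<And>g y. g \<in> carrier G \<Longrightarrow> y \<in> U g \<Longrightarrow> \<phi> g y \<in> U g \<Longrightarrow> \<phi> g y = y"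
    by metis
  show ?thesis
  proof (rule that[of "\<Inter>g\<in>carrier G. U g"])
    show "openin X (\<Inter>g\<in>carrier G. U g)"
      using finite_group U by (intro openin_Inter) auto
  qed (use U in auto)
qed

text \<open>The order of the stabiliser is the sum over g of the indicator functions of the fixed
  point sets, which are both open and closed. This makes the scaling factor of the quasi-basis
  continuous.\<close>

lemma continuous_card_stabilizer:
  assumes op: "\<And>g. g \<in> carrier G \<Longrightarrow> openin X (invariants (topspace X) \<phi> g)"
  shows "continuous_map X euclideanreal (\<lambda>x. real (card (stabilizer G \<phi> x)))"
proof -
  have "continuous_map X euclideanreal (\<lambda>x. if \<phi> g x = x then 1 else 0)"
    if g: "g \<in> carrier G" for g
    unfolding continuous_map_def
  proof (intro conjI allI impI)
    fix T :: "real set"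
    have I: "openin X {x \<in> topspace X. \<phi> g x = x}"
      using op[OF g] by (simp add: invariants_def)
    have "openin X (topspace X - {x \<in> topspace X. \<phi> g x = x})"
      using closedin_invariants[OF g] by (auto simp: invariants_def)
    also have "topspace X - {x \<in> topspace X. \<phi> g x = x} = {x \<in> topspace X. \<phi> g x \<noteq> x}"
      by auto
    finally have "openin X ((if 1 \<in> T then {x \<in> topspace X. \<phi> g x = x} else {})
        \<union> (if 0 \<in> T then {x \<in> topspace X. \<phi> g x \<noteq> x} else {}))"
      using I by auto
    also have "(if 1 \<in> T then {x \<in> topspace X. \<phi> g x = x} else {})
        \<union> (if 0 \<in> T then {x \<in> topspace X. \<phi> g x \<noteq> x} else {})
        = {x \<in> topspace X. (if \<phi> g x = x then 1 else 0) \<in> T}"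
      by auto
    finally show "openin X {x \<in> topspace X. (if \<phi> g x = x then 1 else 0) \<in> T}" .
  qed simp
  then have "continuous_map X euclideanreal (\<lambda>x. \<Sum>g\<in>carrier G. if \<phi> g x = x then 1 else 0)"
    by (intro continuous_map_sum finite_group)
  also have "(\<lambda>x. \<Sum>g\<in>carrier G. if \<phi> g x = x then 1 else 0)
      = (\<lambda>x. real (card (stabilizer G \<phi> x)))"
    using finite_group by (simp add: sum.If_cases Int_def stabilizer_def)
  finally show ?thesis .
qed

lemma exists_quasi_basis:
  assumes op: "\<And>g. g \<in> carrier G \<Longrightarrow> openin X (invariants (topspace X) \<phi> g)"
  shows "\<exists>n v. quasi_basis A E n v"
proof -
  \<comment> \<open>A bump function at x vanishing outside a small neighbourhood; what is kept is
    that it cannot be nonzero at two distinct points of one orbit.\<close>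
  have "\<exists>f. continuous_map X euclideanreal f \<and> f x = 1 \<and>
      (\<forall>y\<in>topspace X. \<forall>g\<in>carrier G. f y \<noteq> 0 \<longrightarrow> f (\<phi> g y) \<noteq> 0 \<longrightarrow> \<phi> g y = y)"
    if x: "x \<in> topspace X" for x
  proof -
    obtain U where U: "openin X U" "x \<in> U"
      "\<And>g y. g \<in> carrier G \<Longrightarrow> y \<in> U \<Longrightarrow> \<phi> g y \<in> U \<Longrightarrow> \<phi> g y = y"
      using exists_small_neighbourhood[OF op x] by blast
    obtain f :: "'x \<Rightarrow> real" where f: "continuous_map X euclidean f" "f x = 1"
      "f ` (topspace X - U) \<subseteq> {0}"
      using completely_regular U(1,2)
      unfolding completely_regular_space_gen_alt'[of 1 "0 :: real" X, OF one_neq_zero] by blast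
    have "y \<in> U" if "y \<in> topspace X" "f y \<noteq> 0" for y
      using f(3) that by blast
    then show ?thesis
      using f U(3) action_closed by blast
  qed
  then obtain f :: "'x \<Rightarrow> 'x \<Rightarrow> real" where fc: "\<And>x. x \<in> topspace X \<Longrightarrow> continuous_map X euclideanreal (f x)"
    and f1: "\<And>x. x \<in> topspace X \<Longrightarrow> f x x = 1"
    and fs: "\<And>x y g. \<lbrakk>x \<in> topspace X; y \<in> topspace X; g \<in> carrier G; f x y \<noteq> 0; f x (\<phi> g y) \<noteq> 0\<rbrakk>
      \<Longrightarrow> \<phi> g y = y"
    by metis
  define P where "P = (\<lambda>x. {y \<in> topspace X. f x y \<in> - {0}})"
  have "openin X (P x)" if "x \<in> topspace X" for x
    unfolding P_def by (rule openin_continuous_map_preimage[OF fc[OF that]]) auto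
  moreover have "topspace X \<subseteq> \<Union>(P ` topspace X)"
    using f1 by (force simp: P_def)
  ultimately obtain \<F> where "finite \<F>" "\<F> \<subseteq> P ` topspace X" "topspace X \<subseteq> \<Union>\<F>"
    using compact unfolding compact_space_alt by (metis (no_types, lifting) imageE)
  then obtain F where F: "finite F" "F \<subseteq> topspace X" "topspace X \<subseteq> \<Union>(P ` F)"
    by (metis finite_subset_image)
  \<comment> \<open>Quasi-bases are indexed from 1, so the finite set of centres is enumerated
    accordingly.\<close>
  obtain p where p: "bij_betw p {1..card F} F"
    using ex_bij_betw_nat_finite_1[OF F(1)] by blast
  \<comment> \<open>The normalising sum of the partition of unity. The bump functions may take
    negative values, hence the absolute values; S is positive because the sets \<open>P x\<close>
    with x in F cover the space.\<close>
  define S where "S = (\<lambda>y. \<Sum>x\<in>F. \<bar>f x y\<bar>)"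
  have S: "0 < S y" if y: "y \<in> topspace X" for y
  proof -
    obtain x where "x \<in> F" "f x y \<noteq> 0"
      using F(3) y by (auto simp: P_def)
    then show ?thesis
      unfolding S_def using F(1) by (intro sum_pos2[of F x]) auto
  qed
  \<comment> \<open>The square root of the partition member \<open>\<bar>f x y\<bar> / S y\<close>
    times the wanted index at y, so that the squares of the \<open>w x y\<close> over F add up to
    that index.\<close>
  define w where "w = (\<lambda>x y. sqrt (\<bar>f x y\<bar> * real (order G) / (real (card (stabilizer G \<phi> y)) * S y)))"
  have wc: "continuous_map X euclideanreal (w x)" if "x \<in> F" for x
  proof -
    have "continuous_map X euclideanreal S"
      unfolding S_def using F fc by (intro continuous_map_sum continuous_map_real_abs) auto
    then show ?thesis
      unfolding w_def using that F(2) S card_stabilizer_pos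
      by (intro continuous_map_sqrt continuous_map_real_divide continuous_map_real_mult
          continuous_map_real_abs fc continuous_map_canonical_const continuous_card_stabilizer op)
        (auto simp: less_imp_neq[symmetric])
  qed
  define v where "v = (\<lambda>i. \<lambda>y\<in>topspace X. complex_of_real (w (p i) y))"
  have pF: "p i \<in> F" if "i \<in> {1..card F}" for i
    using p that by (auto simp: bij_betw_def)
  have ker: "kernel (card F) v y z = complex_of_real (\<Sum>x\<in>F. w x y * w x z)"
    if "y \<in> topspace X" "z \<in> topspace X" for y z
  proof -
    have "kernel (card F) v y z = (\<Sum>i\<in>{1..card F}. complex_of_real (w (p i) y * w (p i) z))"
      using that by (simp add: kernel_def v_def)
    also have "\<dots> = (\<Sum>x\<in>F. complex_of_real (w x y * w x z))"
      by (rule sum.reindex_bij_betw[OF p])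
    finally show ?thesis
      by simp
  qed
  have "quasi_basis A E (card F) v"
    unfolding quasi_basis_iff
  proof (intro conjI ballI)
    show "v i \<in> carrier A" if "i \<in> {1..card F}" for i
      using wc[OF pF[OF that]] by (simp add: v_def cont_algebra_simps cont_algebra_continuous)
    fix y g assume y: "y \<in> topspace X" and g: "g \<in> carrier G"
    show "kernel (card F) v y (\<phi> g y)
      = (if \<phi> g y = y then of_nat (order G) / of_nat (card (stabilizer G \<phi> y)) else 0)"
    proof (cases "\<phi> g y = y")
      case True
      have "(\<Sum>x\<in>F. w x y * w x y)
          = (\<Sum>x\<in>F. \<bar>f x y\<bar> * (real (order G) / (real (card (stabilizer G \<phi> y)) * S y)))"
        using S[OF y] by (intro sum.cong) (simp_all add: w_def)
      also have "\<dots> = S y * (real (order G) / (real (card (stabilizer G \<phi> y)) * S y))"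
        by (simp only: S_def sum_distrib_right)
      also have "\<dots> = real (order G) / real (card (stabilizer G \<phi> y))"
        using S[OF y] by simp
      finally show ?thesis
        using True ker[OF y y] by simp
    next
      case False
      \<comment> \<open>Each bump function vanishes at y or at its distinct translate, and
        \<open>w x\<close> vanishes with it.\<close>
      have "w x y * w x (\<phi> g y) = 0" if "x \<in> F" for x
        using fs[of x y g] that F(2) y g False by (auto simp: w_def)
      then have "(\<Sum>x\<in>F. w x y * w x (\<phi> g y)) = 0"
        by (intro sum.neutral ballI)
      then show ?thesis
        using False ker[OF y action_closed[OF g y]] by (simp del: of_real_mult of_real_sum)
    qed
  qed
  then show ?thesis
    by blast
qed

text \<open>The clauses on the algebra, the subalgebra and the faithful expectation are established
  above, which leaves the existence of a quasi-basis.\<close>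

lemma index_finite_type_iff:
  "index_finite_type A (fixed_point_algebra G X \<phi>) E \<longleftrightarrow> (\<exists>n v. quasi_basis A E n v)"
  unfolding index_finite_type_def
  using unital_cstar_algebra_cont_algebra[OF compact]
    unital_cstar_subalgebra_fixed_point_algebra faithful_conditional_expectation_expectation
  by blast

end

theorem theorem4p10:
  fixes X :: "'x topology" and G :: "('g, 'm) monoid_scheme" and \<phi> :: "'g \<Rightarrow> 'x \<Rightarrow> 'x"
  assumes "compact_space X" and "Hausdorff_space X"
    and "group G" and "finite (carrier G)"
    and "acts_by_homeomorphisms G X \<phi>"
  shows "(index_finite_type (cont_algebra X) (fixed_point_algebra G X \<phi>)
            (canonical_expectation G X \<phi>)
          \<longleftrightarrow> (\<forall>H. subgroup H G \<longrightarrow> closedin X (isotropy_set G X \<phi> H)))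
       \<and> (index_finite_type (cont_algebra X) (fixed_point_algebra G X \<phi>)
            (canonical_expectation G X \<phi>)
          \<longrightarrow> Index (cont_algebra X) (canonical_expectation G X \<phi>)
              = (\<lambda>x\<in>topspace X. \<Sum>H | subgroup H G.
                   of_nat (order G) / of_nat (card H) * indicator (isotropy_set G X \<phi> H) x))"
proof -
  interpret finite_homeomorphism_action X G \<phi>
    using assms by (simp add: finite_homeomorphism_action_def finite_homeomorphism_action_axioms_def)
  \<comment> \<open>Openness of all fixed point sets is the intermediate condition linking the two
    sides.\<close>
  have "index_finite_type A (fixed_point_algebra G X \<phi>) E
      \<longleftrightarrow> (\<forall>H. subgroup H G \<longrightarrow> closedin X (isotropy_set G X \<phi> H))"
    unfolding index_finite_type_iff closedin_isotropy_sets_iff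
    using quasi_basis_imp_openin_invariants exists_quasi_basis by blast
  moreover have "Index A E = (\<lambda>x\<in>topspace X. \<Sum>H | subgroup H G.
      of_nat (order G) / of_nat (card H) * indicator (isotropy_set G X \<phi> H) x)"
    if fin: "index_finite_type A (fixed_point_algebra G X \<phi>) E"
  proof -
    obtain n v where "quasi_basis A E n v"
      using fin index_finite_type_iff by blast
    then show ?thesis
      unfolding Index_eq[OF \<open>quasi_basis A E n v\<close>]
      by (intro restrict_ext sum_indicator_isotropy_set[symmetric])
  qed
  ultimately show ?thesis
    by blast
qed

end
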